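(* Let $K\subset\mathbb{R}^{n+m}$ be a regular partially convex set and let $Y=\pi_2(K)$. If $f$ is a continuous partially affine function on $K$, then there exist unique continuous functions $c_0,c_1,\dots,c_n:Y\to\mathbb{R}$ such that for all $(x,y)\in K$, $$f(x,y)=c_0(y)+\sum_{i=1}^n c_i(y)x_i.$$
   Context: Elements of $\mathbb{R}^{n+m}$ are written $(x,y)$ with $x\in\mathbb{R}^n$, $y\in\mathbb{R}^m$; $\pi_2(K)=\{y\in\mathbb{R}^m:\exists x,\ (x,y)\in K\}$ and $K_y=\{x\in\mathbb{R}^n:(x,y)\in K\}$. A closed set $K\subset\mathbb{R}^{n+m}$ is a regular partially convex set if (1) $K_y$ is convex for all $y\in\pi_2(K)$; (2) the interior $\operatorname{int}(K_y)$ in $\mathbb{R}^n$ is nonempty for all $y\in\pi_2(K)$; (3) the set-valued map $y\mapsto\operatorname{int}(K_y)$ on $\pi_2(K)$ is lower hemicontinuous: for every $y\in\pi_2(K)$, every sequence $y_k\to y$ in $\pi_2(K)$ and every $x\in\operatorname{int}(K_y)$ there are $x_k\in\operatorname{int}(K_{y_k})$ with $x_k\to x$. A continuous partially affine function on $K$ is a continuous $f:K\to\mathbb{R}$ such that for each fixed $y$ the function $x\mapsto f(x,y)$ is affine on $K_y$. *)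

theory Defs
  imports "HOL-Analysis.Analysis"
begin

(* R^(n+m) is the product type real^'n * real^'m; the projection pi_2(K) is snd ` K. *)

definition fibre :: "('a \<times> 'b) set \<Rightarrow> 'b \<Rightarrow> 'a set"
  where "fibre K y = {x. (x, y) \<in> K}"

definition lower_hemicontinuous_on ::
    "'b::topological_space set \<Rightarrow> ('b \<Rightarrow> 'a::topological_space set) \<Rightarrow> bool"
  where "lower_hemicontinuous_on Y F \<longleftrightarrow>
    (\<forall>y\<in>Y. \<forall>ys. (\<forall>k::nat. ys k \<in> Y) \<and> ys \<longlonglongrightarrow> y \<longrightarrow>
      (\<forall>x\<in>F y. \<exists>xs. (\<forall>k::nat. xs k \<in> F (ys k)) \<and> xs \<longlonglongrightarrow> x))"

definition regular_partially_convex :: "((real ^ 'n) \<times> (real ^ 'm)) set \<Rightarrow> bool"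
  where "regular_partially_convex K \<longleftrightarrow>
    closed K \<and>
    (\<forall>y\<in>snd ` K. convex (fibre K y)) \<and>
    (\<forall>y\<in>snd ` K. interior (fibre K y) \<noteq> {}) \<and>
    lower_hemicontinuous_on (snd ` K) (\<lambda>y. interior (fibre K y))"

(* Only meant for convex S, where it says that g preserves convex combinations; it does not
   presuppose that g extends to an affine function on the whole space. *)
definition affine_on_convex :: "'a::real_vector set \<Rightarrow> ('a \<Rightarrow> real) \<Rightarrow> bool"
  where "affine_on_convex S g \<longleftrightarrow>
    (\<forall>a\<in>S. \<forall>b\<in>S. \<forall>u\<ge>0. \<forall>v\<ge>0. u + v = 1 \<longrightarrow>
      g (u *\<^sub>R a + v *\<^sub>R b) = u * g a + v * g b)"

(* Only the values of f on K matter. *)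
definition continuous_partially_affine_on ::
    "((real ^ 'n) \<times> (real ^ 'm)) set \<Rightarrow> ((real ^ 'n) \<times> (real ^ 'm) \<Rightarrow> real) \<Rightarrow> bool"
  where "continuous_partially_affine_on K f \<longleftrightarrow>
    continuous_on K f \<and>
    (\<forall>y\<in>snd ` K. affine_on_convex (fibre K y) (\<lambda>x. f (x, y)))"

end

theory Submission
  imports Defs
begin

text \<open>
  For a single \<open>y\<close>, an affine function on a convex set with nonempty interior is the restriction of
  exactly one function \<open>\<lambda>x. b + w \<bullet> x\<close> (\<open>affine_on_convex_imp_inner\<close>, \<open>inner_rep_unique\<close>). Doing
  this in each fibre gives the coefficients, and the interior of the fibres makes them unique, so
  the content of the theorem is that they depend continuously on \<open>y\<close>.

  Let \<open>y\<^sub>k \<rightarrow> y\<close> in \<open>Y\<close>. In the interior of the fibre over \<open>y\<close> there are points \<open>a\<close> and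
  \<open>a + e \<cdot> axis i 1\<close>. By lower hemicontinuity they are limits of points \<open>p\<^sub>k\<close> and \<open>q\<^sub>k\<^sub>i\<close> of the fibres
  over \<open>y\<^sub>k\<close>, where \<open>f\<close> converges because it is jointly continuous. The gradient \<open>w y\<^sub>k\<close> solves the
  linear system with rows \<open>q\<^sub>k\<^sub>i - p\<^sub>k\<close> and right-hand sides \<open>f (q\<^sub>k\<^sub>i, y\<^sub>k) - f (p\<^sub>k, y\<^sub>k)\<close>. Both sides of
  the system converge, and the limit matrix \<open>e \<cdot> 1\<close> is invertible, so by Cramer's rule the solutions
  converge as well (\<open>tendsto_linear_system_solution\<close>). The constant term \<open>f (p\<^sub>k, y\<^sub>k) - w y\<^sub>k \<bullet> p\<^sub>k\<close>
  then converges too.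
\<close>

section \<open>Affine functions on convex sets with interior\<close>

lemma affine_on_convexD:
  assumes "affine_on_convex S g" "a \<in> S" "b \<in> S" "0 \<le> t" "t \<le> 1"
  shows "g ((1 - t) *\<^sub>R a + t *\<^sub>R b) = (1 - t) * g a + t * g b"
proof -
  have "1 - t \<ge> 0" "1 - t + t = 1" using assms by auto
  with assms show ?thesis unfolding affine_on_convex_def by blast
qed

text \<open>
  Along a ray that starts at the zero \<open>a\<close>, an affine function is determined by its value at any one
  further point of the ray.
\<close>

lemma affine_on_convex_zero_along_ray:
  assumes aff: "affine_on_convex S g" and "a \<in> S" "g a = 0"
    and "b \<in> S" "0 < t" "t \<le> 1" and "g ((1 - t) *\<^sub>R a + t *\<^sub>R b) = 0"
  shows "g b = 0"
  using affine_on_convexD[OF aff \<open>a \<in> S\<close> \<open>b \<in> S\<close>, of t] assms by auto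

lemma convex_zero_set_affine_on_convex:
  assumes "convex S" and aff: "affine_on_convex S g"
  shows "convex {x \<in> S. g x = 0}"
proof (rule convexI)
  fix x y and u v :: real
  assume *: "x \<in> {x \<in> S. g x = 0}" "y \<in> {x \<in> S. g x = 0}" "0 \<le> u" "0 \<le> v" "u + v = 1"
  then have "g (u *\<^sub>R x + v *\<^sub>R y) = u * g x + v * g y"
    using aff unfolding affine_on_convex_def by blast
  moreover have "u *\<^sub>R x + v *\<^sub>R y \<in> S"
    using * \<open>convex S\<close> by (auto intro: convexD)
  ultimately show "u *\<^sub>R x + v *\<^sub>R y \<in> {x \<in> S. g x = 0}" using * by simp
qed

text \<open>
  The zero set is convex, so it contains, together with the points \<open>a + s \<cdot> i\<close> on the coordinate
  axes through \<open>a\<close>, all points near \<open>a\<close> (averages over \<open>i\<close> of axis points); rays from \<open>a\<close> then carry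
  the zeros from the neighbourhood of \<open>a\<close> to all of \<open>S\<close>.
\<close>

lemma affine_on_convex_zero:
  fixes S :: "'a::euclidean_space set"
  assumes "convex S" and aff: "affine_on_convex S g"
    and "e > 0" and ball: "cball a e \<subseteq> S"
    and ga: "g a = 0" and gi: "\<And>i. i \<in> Basis \<Longrightarrow> g (a + e *\<^sub>R i) = 0"
    and "x \<in> S"
  shows "g x = 0"
proof -
  have inS: "a + s *\<^sub>R i \<in> S" if "\<bar>s\<bar> \<le> e" "i \<in> Basis" for s i
    using that ball by (auto intro!: subsetD[OF ball] simp: dist_norm)
  have aS: "a \<in> S" using ball \<open>e > 0\<close> by auto
  have axis: "g (a + s *\<^sub>R i) = 0" if s: "\<bar>s\<bar> \<le> e" and i: "i \<in> Basis" for s i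
  proof (cases "s \<ge> 0")
    case True
    have eq: "(1 - s/e) *\<^sub>R a + (s/e) *\<^sub>R (a + e *\<^sub>R i) = a + s *\<^sub>R i"
      using \<open>e > 0\<close> by (simp add: algebra_simps)
    show ?thesis
      using affine_on_convexD[OF aff aS inS[of e i], of "s/e"] True s i \<open>e > 0\<close> ga gi
      by (simp add: eq)
  next
    case False
    \<comment> \<open>Here \<open>a\<close> lies between \<open>a + s \<cdot> i\<close> and the zero \<open>a + e \<cdot> i\<close>.\<close>
    define t where "t = e / (e - s)"
    have t: "0 < t" "t \<le> 1" using False \<open>e > 0\<close> by (auto simp: t_def field_simps)
    have "(1 - t) * e + t * s = 0"
      using False \<open>e > 0\<close> by (simp add: t_def field_simps)
    then have "((1 - t) * e + t * s) *\<^sub>R i = 0" by simp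
    then have eq: "(1 - t) *\<^sub>R (a + e *\<^sub>R i) + t *\<^sub>R (a + s *\<^sub>R i) = a"
      by (simp add: algebra_simps)
    show ?thesis
      by (rule affine_on_convex_zero_along_ray[OF aff inS[of e i] gi[OF i] inS[OF s i] t])
        (use i \<open>e > 0\<close> ga eq in auto)
  qed
  define n where "n = real DIM('a)"
  have n: "n \<ge> 1" by (simp add: n_def Suc_leI)
  \<comment> \<open>Averaging over \<open>n\<close> axes divides each offset by \<open>n\<close>, so the axis points that produce
    \<open>a + t \<cdot> (x - a)\<close> have offsets scaled up by \<open>n\<close>; \<open>t\<close> keeps these below \<open>e\<close>.\<close>
  define t where "t = min 1 (e / (n * (norm (x - a) + 1)))"
  have pos: "n * (norm (x - a) + 1) > 0"
    using n by (intro mult_pos_pos) (auto simp: add_nonneg_pos)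
  have t: "0 < t" "t \<le> 1" using pos \<open>e > 0\<close> by (auto simp: t_def)
  have "t * (n * (norm (x - a) + 1)) \<le> e"
    unfolding pos_le_divide_eq[OF pos, symmetric] by (simp add: t_def)
  moreover have "t * (n * norm (x - a)) \<le> t * (n * (norm (x - a) + 1))"
    using t n by (intro mult_left_mono) auto
  ultimately have tn: "n * t * norm (x - a) \<le> e" by (simp add: mult_ac)
  have small: "\<bar>n * t * ((x - a) \<bullet> i)\<bar> \<le> e" if "i \<in> Basis" for i
  proof -
    have "\<bar>n * t * ((x - a) \<bullet> i)\<bar> = n * t * \<bar>(x - a) \<bullet> i\<bar>"
      using n t by (simp add: abs_mult)
    also have "\<dots> \<le> n * t * norm (x - a)"
      using n t Basis_le_norm[OF that] by (intro mult_left_mono) auto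
    finally show ?thesis using tn by simp
  qed
  have "(\<Sum>i\<in>Basis. (1/n) *\<^sub>R (a + (n * t * ((x - a) \<bullet> i)) *\<^sub>R i)) \<in> {x \<in> S. g x = 0}"
    by (rule convex_sum[OF _ convex_zero_set_affine_on_convex[OF \<open>convex S\<close> aff]])
      (use small in \<open>auto simp: n_def inS axis\<close>)
  also have "(\<Sum>i\<in>Basis. (1/n) *\<^sub>R (a + (n * t * ((x - a) \<bullet> i)) *\<^sub>R i))
      = (\<Sum>i\<in>(Basis::'a set). (1/n) *\<^sub>R a) + t *\<^sub>R (\<Sum>i\<in>Basis. ((x - a) \<bullet> i) *\<^sub>R i)"
    using n by (simp add: scaleR_add_right sum.distrib scaleR_sum_right)
  also have "(\<Sum>i\<in>(Basis::'a set). (1/n) *\<^sub>R a) = a"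
    using n by (simp add: n_def sum_constant_scaleR)
  also have "(\<Sum>i\<in>Basis. ((x - a) \<bullet> i) *\<^sub>R i) = x - a"
    by (rule euclidean_representation)
  also have "a + t *\<^sub>R (x - a) = (1 - t) *\<^sub>R a + t *\<^sub>R x"
    by (simp add: algebra_simps)
  finally show ?thesis
    using affine_on_convex_zero_along_ray[OF aff aS ga \<open>x \<in> S\<close> t] by simp
qed

text \<open>
  The difference quotients of \<open>g\<close> at an interior point give the only possible \<open>w\<close>; subtracting the
  resulting affine function leaves one that vanishes by \<open>affine_on_convex_zero\<close>.
\<close>

lemma affine_on_convex_imp_inner:
  fixes S :: "'a::euclidean_space set"
  assumes "convex S" and "interior S \<noteq> {}" and aff: "affine_on_convex S g"
  obtains b w where "\<And>x. x \<in> S \<Longrightarrow> g x = b + w \<bullet> x"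
proof -
  obtain a e where e: "e > 0" "cball a e \<subseteq> S"
    using \<open>interior S \<noteq> {}\<close> by (auto simp: mem_interior_cball)
  define w where "w = (\<Sum>i\<in>Basis. ((g (a + e *\<^sub>R i) - g a) / e) *\<^sub>R i)"
  define h where "h x = g x - g a - w \<bullet> (x - a)" for x
  have "affine_on_convex S h"
    unfolding affine_on_convex_def
  proof (intro ballI allI impI)
    fix p q and u v :: real
    assume *: "p \<in> S" "q \<in> S" "0 \<le> u" "0 \<le> v" "u + v = 1"
    have g: "g (u *\<^sub>R p + v *\<^sub>R q) = u * g p + v * g q"
      using aff * unfolding affine_on_convex_def by blast
    have v: "v = 1 - u" using * by simp
    show "h (u *\<^sub>R p + v *\<^sub>R q) = u * h p + v * h q"
      unfolding h_def g unfolding v by (simp add: inner_simps algebra_simps)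
  qed
  moreover have "h (a + e *\<^sub>R i) = 0" if "i \<in> Basis" for i
    using that e by (simp add: h_def w_def)
  ultimately have "h x = 0" if "x \<in> S" for x
    using affine_on_convex_zero[of S h e a x] \<open>convex S\<close> e that by (simp add: h_def)
  then have "g x = (g a - w \<bullet> a) + w \<bullet> x" if "x \<in> S" for x
    using that by (force simp: h_def inner_diff_right)
  then show ?thesis by (rule that)
qed

lemma inner_rep_unique:
  fixes S :: "'a::euclidean_space set"
  assumes "interior S \<noteq> {}" and eq: "\<And>x. x \<in> S \<Longrightarrow> b + w \<bullet> x = b' + w' \<bullet> x"
  shows "b = b'" and "w = w'"
proof -
  obtain a e where e: "e > 0" "cball a e \<subseteq> S"
    using \<open>interior S \<noteq> {}\<close> by (auto simp: mem_interior_cball)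
  then have a: "a \<in> S" by auto
  show "w = w'"
  proof (rule euclidean_eqI)
    fix i :: 'a assume "i \<in> Basis"
    then have "a + e *\<^sub>R i \<in> S"
      using e by (auto intro!: subsetD[OF e(2)] simp: dist_norm)
    with eq[OF a] eq[of "a + e *\<^sub>R i"] have "e * (w \<bullet> i) = e * (w' \<bullet> i)"
      unfolding inner_add_right inner_scaleR_right by linarith
    with e show "w \<bullet> i = w' \<bullet> i" by simp
  qed
  with eq[OF a] show "b = b'" by simp
qed

section \<open>Solutions of convergent linear systems\<close>

lemma tendsto_det:
  fixes A :: "'b \<Rightarrow> real ^ 'n ^ 'n"
  assumes "(A \<longlongrightarrow> L) F"
  shows "((\<lambda>k. det (A k)) \<longlongrightarrow> det L) F"
  unfolding det_def by (intro tendsto_intros assms)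

text \<open>
  Cramer's rule writes the solution as a quotient of determinants, which is continuous in the matrix
  and the right-hand side where the matrix is invertible; the \<open>A k\<close> are
  eventually invertible because \<open>L\<close> is.
\<close>

lemma tendsto_linear_system_solution:
  fixes A :: "'b \<Rightarrow> real ^ 'n ^ 'n"
  assumes A: "(A \<longlongrightarrow> L) F" and Aw: "((\<lambda>k. A k *v w k) \<longlongrightarrow> L *v v) F"
    and "det L \<noteq> 0"
  shows "(w \<longlongrightarrow> v) F"
proof -
  define C where "C M b = (\<chi> j. det (\<chi> i l. if l = j then b $ i else M $ i $ l) / det M)"
    for M :: "real ^ 'n ^ 'n" and b
  have C: "x = C M (M *v x)" if "det M \<noteq> 0" for M x
    using cramer[OF that, of x "M *v x"] unfolding C_def by blast
  have comp: "((\<lambda>k. if l = j then (A k *v w k) $ i else A k $ i $ l)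
      \<longlongrightarrow> (if l = j then (L *v v) $ i else L $ i $ l)) F" for i j l
    by (cases "l = j") (auto intro!: tendsto_vec_nth A Aw)
  have "((\<lambda>k. C (A k) (A k *v w k)) \<longlongrightarrow> C L (L *v v)) F"
    unfolding C_def
    by (intro tendsto_vec_lambda tendsto_divide tendsto_det A comp \<open>det L \<noteq> 0\<close>)
  moreover have "\<forall>\<^sub>F k in F. C (A k) (A k *v w k) = w k"
    using tendsto_imp_eventually_ne[OF tendsto_det[OF A] \<open>det L \<noteq> 0\<close>]
    by eventually_elim (simp add: C[symmetric])
  ultimately show ?thesis
    using C[OF \<open>det L \<noteq> 0\<close>, of v] by (simp add: tendsto_cong)
qed

section \<open>Continuity of the coefficients\<close>

text \<open>
  The interior point \<open>a\<close> and its \<open>n\<close> neighbours in the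
  axis directions are \<open>n + 1\<close> affinely independent points, just enough for their values of \<open>f\<close> to
  determine the \<open>n + 1\<close> coefficients.
\<close>

lemma fibre_inner_rep_tendsto:
  fixes K :: "((real ^ 'n) \<times> (real ^ 'm)) set"
  assumes K: "regular_partially_convex K" and f: "continuous_on K f"
    and rep: "\<And>x y. (x, y) \<in> K \<Longrightarrow> f (x, y) = b y + w y \<bullet> x"
    and ys: "\<And>k. ys k \<in> snd ` K" and y: "y \<in> snd ` K" and lim: "ys \<longlonglongrightarrow> y"
  shows "(\<lambda>k. w (ys k)) \<longlonglongrightarrow> w y" and "(\<lambda>k. b (ys k)) \<longlonglongrightarrow> b y"
proof -
  let ?I = "\<lambda>y. interior (fibre K y)"
  have IK: "(x, z) \<in> K" if "x \<in> ?I z" for x z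
    using that interior_subset[of "fibre K z"] by (auto simp: fibre_def)
  have approx: "\<exists>xs. (\<forall>k. xs k \<in> ?I (ys k)) \<and> xs \<longlonglongrightarrow> x" if "x \<in> ?I y" for x
    using K that ys y lim unfolding regular_partially_convex_def lower_hemicontinuous_on_def
    by blast
  have flim: "(\<lambda>k. f (xs k, ys k)) \<longlonglongrightarrow> f (x, y)"
    if "\<And>k. xs k \<in> ?I (ys k)" "xs \<longlonglongrightarrow> x" "x \<in> ?I y" for xs x
    by (rule continuous_on_tendsto_compose[OF f tendsto_Pair[OF that(2) lim]])
      (use that IK in auto)
  obtain a where "a \<in> ?I y"
    using K y unfolding regular_partially_convex_def by blast
  then obtain e where e: "e > 0" "cball a e \<subseteq> ?I y"
    using open_contains_cball[of "?I y"] by auto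
  have a: "a \<in> ?I y" by fact
  have ai: "a + e *\<^sub>R axis i 1 \<in> ?I y" for i
    using e by (auto intro!: subsetD[OF e(2)] simp: dist_norm norm_axis_1)
  obtain p where p: "\<And>k. p k \<in> ?I (ys k)" "p \<longlonglongrightarrow> a"
    using approx[OF a] by blast
  have "\<forall>i. \<exists>xs. (\<forall>k. xs k \<in> ?I (ys k)) \<and> xs \<longlonglongrightarrow> a + e *\<^sub>R axis i 1"
    using approx[OF ai] by blast
  then obtain q where q: "\<And>i k. q i k \<in> ?I (ys k)" "\<And>i. q i \<longlonglongrightarrow> a + e *\<^sub>R axis i 1"
    by metis
  define A where "A k = (\<chi> i. q i k - p k)" for k
  define L :: "real ^ 'n ^ 'n" where "L = (\<chi> i. e *\<^sub>R axis i 1)"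
  have "(\<lambda>k. A k) \<longlonglongrightarrow> (\<chi> i. a + e *\<^sub>R axis i 1 - a)"
    unfolding A_def by (intro tendsto_vec_lambda tendsto_diff q p)
  then have AL: "A \<longlonglongrightarrow> L" by (simp add: L_def)
  have "det L = (\<Prod>i\<in>UNIV. L $ i $ i)"
    by (rule det_diagonal) (simp add: L_def axis_def)
  then have detL: "det L \<noteq> 0" using e by (simp add: L_def axis_def)
  have Aw: "A k *v w (ys k) = (\<chi> i. f (q i k, ys k) - f (p k, ys k))" for k
    using rep[OF IK[OF q(1)]] rep[OF IK[OF p(1)]]
    by (simp add: vec_eq_iff A_def matrix_vector_mul_component inner_simps inner_commute)
  have Lw: "L *v w y = (\<chi> i. f (a + e *\<^sub>R axis i 1, y) - f (a, y))"
    using rep[OF IK[OF ai]] rep[OF IK[OF a]]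
    by (simp add: vec_eq_iff L_def matrix_vector_mul_component inner_simps inner_commute)
  have "(\<lambda>k. A k *v w (ys k)) \<longlonglongrightarrow> L *v w y"
    unfolding Aw Lw by (intro tendsto_vec_lambda tendsto_diff flim q p a ai)
  then show wlim: "(\<lambda>k. w (ys k)) \<longlonglongrightarrow> w y"
    by (rule tendsto_linear_system_solution[OF AL _ detL])
  have "(\<lambda>k. f (p k, ys k) - w (ys k) \<bullet> p k) \<longlonglongrightarrow> f (a, y) - w y \<bullet> a"
    by (intro tendsto_diff tendsto_inner flim wlim p a)
  then show "(\<lambda>k. b (ys k)) \<longlonglongrightarrow> b y"
    using rep[OF IK[OF p(1)]] rep[OF IK[OF a]] by simp
qed

theorem theorem3p6:
  fixes K :: "((real ^ 'n) \<times> (real ^ 'm)) set"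
    and f :: "(real ^ 'n) \<times> (real ^ 'm) \<Rightarrow> real"
    and Y :: "(real ^ 'm) set"
  assumes "regular_partially_convex K"
    and "Y = snd ` K"
    and "continuous_partially_affine_on K f"
  shows "\<exists>!(c0 :: real ^ 'm \<Rightarrow> real, c :: 'n \<Rightarrow> real ^ 'm \<Rightarrow> real).
    c0 \<in> Y \<rightarrow>\<^sub>E UNIV \<and> (\<forall>i. c i \<in> Y \<rightarrow>\<^sub>E UNIV) \<and>
    continuous_on Y c0 \<and> (\<forall>i. continuous_on Y (c i)) \<and>
    (\<forall>x y. (x, y) \<in> K \<longrightarrow> f (x, y) = c0 y + (\<Sum>i\<in>UNIV. c i y * x $ i))"
proof -
  have int: "interior (fibre K y) \<noteq> {}" if "y \<in> Y" for y
    using assms(1) that unfolding assms(2) regular_partially_convex_def by blast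
  have "\<exists>b w. \<forall>x\<in>fibre K y. f (x, y) = b + w \<bullet> x" if "y \<in> Y" for y
    using affine_on_convex_imp_inner[of "fibre K y" "\<lambda>x. f (x, y)"] int[OF that] assms that
    unfolding regular_partially_convex_def continuous_partially_affine_on_def by metis
  then obtain b w where rep: "\<And>y x. y \<in> Y \<Longrightarrow> x \<in> fibre K y \<Longrightarrow> f (x, y) = b y + w y \<bullet> x"
    by metis
  have repK: "f (x, y) = b y + w y \<bullet> x" if "(x, y) \<in> K" for x y
    using rep[of y x] that unfolding assms(2) by (force simp: fibre_def)
  have f: "continuous_on K f"
    using assms(3) by (simp add: continuous_partially_affine_on_def)
  note lim = fibre_inner_rep_tendsto[OF assms(1) f repK, folded assms(2)]
  have cont: "continuous_on Y b" "continuous_on Y w"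
    unfolding continuous_on_sequentially comp_def by (auto intro: lim)
  \<comment> \<open>Uniqueness refers to functions on \<open>Y\<close>, hence the restrictions.\<close>
  define c0 where "c0 = restrict b Y"
  define c where "c i = restrict (\<lambda>y. w y $ i) Y" for i
  show ?thesis
  proof (rule ex1I[of _ "(c0, c)"], goal_cases)
    case 1
    have "continuous_on Y c0"
      using cont(1) by (rule continuous_on_eq) (simp add: c0_def)
    moreover have "continuous_on Y (c i)" for i
      by (rule continuous_on_eq[of Y "\<lambda>y. w y $ i"])
        (auto simp: c_def intro!: continuous_intros cont)
    moreover have "f (x, y) = c0 y + (\<Sum>i\<in>UNIV. c i y * x $ i)" if "(x, y) \<in> K" for x y
    proof -
      have "y \<in> Y" using that unfolding assms(2) by force
      with repK[OF that] show ?thesis by (simp add: c0_def c_def inner_vec_def)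
    qed
    ultimately show ?case by (auto simp: c0_def c_def)
  next
    case (2 d)
    obtain d0 d' where d: "d = (d0, d')" by (cases d)
    with 2 have ext: "d0 \<in> Y \<rightarrow>\<^sub>E UNIV" "\<And>i. d' i \<in> Y \<rightarrow>\<^sub>E UNIV"
      and drep: "\<And>x y. (x, y) \<in> K \<Longrightarrow> f (x, y) = d0 y + (\<Sum>i\<in>UNIV. d' i y * x $ i)"
      by auto
    have "d0 y = b y \<and> (\<chi> i. d' i y) = w y" if "y \<in> Y" for y
    proof -
      have "d0 y + (\<chi> i. d' i y) \<bullet> x = b y + w y \<bullet> x" if "x \<in> fibre K y" for x
        using drep[of x y] repK[of x y] that by (simp add: fibre_def inner_vec_def)
      with inner_rep_unique[OF int[OF that]] show ?thesis by blast
    qed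
    then have "d0 y = b y" "d' i y = w y $ i" if "y \<in> Y" for y i
      using that by (auto simp: vec_eq_iff)
    moreover have "d0 y = undefined" "d' i y = undefined" if "y \<notin> Y" for y i
      using PiE_arb[OF ext(1) that] PiE_arb[OF ext(2) that] by auto
    ultimately show ?case
      by (auto simp: d c0_def c_def fun_eq_iff restrict_def)
  qed
qed

end
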